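(* Let $H$ be a bipartite graph with bipartition $A\cup B$ and $r=\max_{b\in B}\deg(b)$, and, for $k=1,\dots,r$, let $\alpha_k:=d_k/\binom{|A|}{k}$, where $d_k$ is the number of vertices in $B$ of degree $k$. Let $J$ be the $(|A|,r)$-downset graph and $\alpha=(\alpha_k)_{k=1}^r$. Then $t_H(W)\geq t_{J}^{\alpha}(W)$ for every graphon $W$.
   Context: A graphon is a symmetric measurable $W:[0,1]^2\to[0,1]$; for a graph $H$, $t_H(W)=\int\prod_{ij\in E(H)}W(x_i,x_j)\,d\mu^{V(H)}$. Identify $A$ with $[m]$, $m=|A|$. The $(m,r)$-downset graph $J$ has parts $[m]$ and $B_J$ = subsets of $[m]$ of size $1$ to $r$, with $a\sim F$ iff $a\in F$. For $F\subseteq[m]$, $\rho(x_F)=\int_0^1\prod_{i\in F}W(x_i,y)\,dy$, and for non-negative real weights $\alpha_k$, $t_J^{\alpha}(W)=\mathbb{E}_x\left[\prod_{F\in B_J}\rho(x_F)^{\alpha_{|F|}}\right]$ with $x_1,\dots,x_m$ i.i.d. uniform on $[0,1]$. *)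

theory Defs
  imports "HOL-Analysis.Analysis"
begin

record 'v sgraph =
  verts :: "'v set"
  edges :: "'v set set"

definition finite_simple_graph :: "'v sgraph \<Rightarrow> bool" where
  "finite_simple_graph H \<longleftrightarrow>
     finite (verts H) \<and> (\<forall>e\<in>edges H. e \<subseteq> verts H \<and> card e = 2)"

definition nbhd :: "'v sgraph \<Rightarrow> 'v \<Rightarrow> 'v set" where
  "nbhd H v = {u. {u, v} \<in> edges H}"

definition vdegree :: "'v sgraph \<Rightarrow> 'v \<Rightarrow> nat" where
  "vdegree H v = card (nbhd H v)"

definition bipartition :: "'v sgraph \<Rightarrow> 'v set \<Rightarrow> 'v set \<Rightarrow> bool" where
  "bipartition H A B \<longleftrightarrow>
     A \<union> B = verts H \<and> A \<inter> B = {} \<and> (\<forall>e\<in>edges H. \<exists>a\<in>A. \<exists>b\<in>B. e = {a, b})"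

text \<open>Measurability is Lebesgue measurability, which includes the Borel case.
  Only the values of \<open>W\<close> on the unit square are constrained or used.\<close>

definition graphon :: "(real \<times> real \<Rightarrow> real) \<Rightarrow> bool" where
  "graphon W \<longleftrightarrow>
     W \<in> borel_measurable (lebesgue_on ({0..1} \<times> {0..1})) \<and>
     (\<forall>x\<in>{0..1}. \<forall>y\<in>{0..1}. W (x, y) = W (y, x) \<and> 0 \<le> W (x, y) \<and> W (x, y) \<le> 1)"

text \<open>The uniform distribution on \<open>[0,1]\<^sup>V\<close>. It is completed because integrands built from a
  Lebesgue measurable \<open>W\<close> need not be measurable for the product sigma-algebra.\<close>

definition unit_cube :: "'v set \<Rightarrow> ('v \<Rightarrow> real) measure" where
  "unit_cube V = completion (\<Pi>\<^sub>M v\<in>V. restrict_space lborel {0..1})"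

text \<open>The factor \<open>W (x\<^sub>i, x\<^sub>j)\<close> of an edge \<open>{i, j}\<close>; it does not depend on the
  order of the endpoints when \<open>W\<close> is symmetric.\<close>

definition edge_factor :: "(real \<times> real \<Rightarrow> real) \<Rightarrow> ('v \<Rightarrow> real) \<Rightarrow> 'v set \<Rightarrow> real" where
  "edge_factor W x e = (THE w. \<exists>i j. e = {i, j} \<and> w = W (x i, x j))"

definition hom_density :: "'v sgraph \<Rightarrow> (real \<times> real \<Rightarrow> real) \<Rightarrow> real" where
  "hom_density H W = (\<integral>x. (\<Prod>e\<in>edges H. edge_factor W x e) \<partial>unit_cube (verts H))"

definition codegree :: "(real \<times> real \<Rightarrow> real) \<Rightarrow> 'v set \<Rightarrow> ('v \<Rightarrow> real) \<Rightarrow> real" where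
  "codegree W F x = (\<integral>y. (\<Prod>i\<in>F. W (x i, y)) \<partial>lebesgue_on {0..1})"

text \<open>Real powers of non-negative reals with \<open>0\<^sup>0 = 1\<close>, so that weight \<open>0\<close> means an absent
  factor; in contrast, \<open>0 powr 0 = 0\<close>.\<close>

definition wpow :: "real \<Rightarrow> real \<Rightarrow> real" where
  "wpow t a = (if a = 0 then 1 else t powr a)"

definition downset_left :: "nat \<Rightarrow> (nat + nat set) set" where
  "downset_left m = Inl ` {1..m}"

definition downset_right :: "nat \<Rightarrow> nat \<Rightarrow> (nat + nat set) set" where
  "downset_right m r = Inr ` {F. F \<subseteq> {1..m} \<and> 1 \<le> card F \<and> card F \<le> r}"

definition downset_graph :: "nat \<Rightarrow> nat \<Rightarrow> (nat + nat set) sgraph" where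
  "downset_graph m r =
     \<lparr>verts = downset_left m \<union> downset_right m r,
      edges = {{Inl a, Inr F} |a F. Inl a \<in> downset_left m \<and> Inr F \<in> downset_right m r \<and> a \<in> F}\<rparr>"

text \<open>Weighted density of a bipartite graph with parts \<open>A\<close> and \<open>B\<close>. In the downset graph the
  neighbourhood of the right vertex \<open>F\<close> is (the copy of) \<open>F\<close> itself and its degree is \<open>card F\<close>,
  so its factor is \<open>\<rho>(x\<^sub>F)\<close> to the power \<open>\<alpha> (card F)\<close>.\<close>

definition weighted_density ::
  "'v sgraph \<Rightarrow> 'v set \<Rightarrow> 'v set \<Rightarrow> (nat \<Rightarrow> real) \<Rightarrow> (real \<times> real \<Rightarrow> real) \<Rightarrow> real" where
  "weighted_density J A B \<alpha> W =
     (\<integral>x. (\<Prod>v\<in>B. wpow (codegree W (nbhd J v) x) (\<alpha> (vdegree J v))) \<partial>unit_cube A)"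

definition downset_density ::
  "nat \<Rightarrow> nat \<Rightarrow> (nat \<Rightarrow> real) \<Rightarrow> (real \<times> real \<Rightarrow> real) \<Rightarrow> real" where
  "downset_density m r \<alpha> W =
     weighted_density (downset_graph m r) (downset_left m) (downset_right m r) \<alpha> W"

end

theory Submission
  imports Defs "HOL-Probability.Probability"
begin

text \<open>Integrating out the vertices of \<open>B\<close>, the density of \<open>H\<close> is the expectation of
  \<open>\<Prod>b\<in>B. \<rho>(x\<^bsub>N(b)\<^esub>)\<close>. As the coordinates are i.i.d., this does not change when \<open>A\<close> is relabelled
  by a bijection \<open>\<pi>\<close> onto \<open>[m]\<close>, so it equals the expectation of the average over all \<open>\<pi>\<close> of
  \<open>\<Prod>b\<in>B. \<rho>(x\<^bsub>\<pi>(N(b))\<^esub>)\<close>. By AM-GM, pointwise in \<open>x\<close>, the average is at least the geometric mean; there each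
  \<open>b\<close> of degree \<open>k\<close> contributes every \<open>k\<close>-subset \<open>F\<close> of \<open>[m]\<close> equally often, that is \<open>\<rho>(x\<^sub>F)\<close> to the power
  \<open>1 / (m choose k)\<close>, which gives the integrand of the weighted density of the downset graph.
  Replacing \<open>W\<close> by a Borel function that agrees with it almost everywhere makes Fubini's theorem
  available on the uncompleted product.\<close>

section \<open>Bijections between finite sets and the images of a fixed subset\<close>

text \<open>Functions are taken extensional, with a fixed value outside \<open>A\<close>, so that
  each bijection is represented once and finite sets have finitely many of them.\<close>

definition bijections :: "'a set \<Rightarrow> 'b set \<Rightarrow> ('a \<Rightarrow> 'b) set" where
  "bijections A L = {\<pi> \<in> A \<rightarrow>\<^sub>E L. bij_betw \<pi> A L}"

lemma finite_bijections: "finite A \<Longrightarrow> finite L \<Longrightarrow> finite (bijections A L)"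
  unfolding bijections_def by (rule finite_subset[OF _ finite_PiE[of A "\<lambda>_. L"]]) auto

lemma bijections_nonempty:
  assumes "finite A" "finite L" "card A = card L"
  shows "bijections A L \<noteq> {}"
proof -
  obtain f where f: "bij_betw f A L"
    using assms finite_same_card_bij by blast
  then have "restrict f A \<in> bijections A L"
    unfolding bijections_def by (auto simp: bij_betw_def inj_on_def)
  then show ?thesis by blast
qed

lemma bijections_image:
  assumes "\<pi> \<in> bijections A L" "S \<subseteq> A"
  shows "\<pi> ` S \<subseteq> L" "card (\<pi> ` S) = card S"
  using assms unfolding bijections_def
  by (auto simp: bij_betw_def card_image inj_on_subset)

lemma card_bijections_mapping_le:
  assumes "finite A" "finite L" "S \<subseteq> A"
    and "F \<subseteq> L" "F' \<subseteq> L" "card F = card F'"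
  shows "card {\<pi> \<in> bijections A L. \<pi> ` S = F} \<le> card {\<pi> \<in> bijections A L. \<pi> ` S = F'}"
proof -
  have fin: "finite F" "finite F'" using assms finite_subset by blast+
  obtain f where f: "bij_betw f F F'"
    using finite_same_card_bij[OF fin assms(6)] by auto
  have "card (L - F) = card (L - F')"
    by (simp only: card_Diff_subset[OF fin(1) assms(4)] card_Diff_subset[OF fin(2) assms(5)] assms(6))
  then obtain g where g: "bij_betw g (L - F) (L - F')"
    using finite_same_card_bij[of "L - F" "L - F'"] assms(2) by auto
  define \<tau> where "\<tau> = (\<lambda>x. if x \<in> F then f x else g x)"
  have "bij_betw \<tau> (F \<union> (L - F)) (F' \<union> (L - F'))"
    unfolding \<tau>_def by (rule bij_betw_disjoint_Un[OF f g]) auto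
  moreover have "F \<union> (L - F) = L" "F' \<union> (L - F') = L" using assms by auto
  ultimately have \<tau>: "bij_betw \<tau> L L" by simp
  have \<tau>F: "\<tau> ` F = F'"
    using f by (auto simp: \<tau>_def bij_betw_def)
  show ?thesis
  proof (rule card_inj_on_le[where f = "\<lambda>\<pi>. restrict (\<tau> \<circ> \<pi>) A"])
    show "inj_on (\<lambda>\<pi>. restrict (\<tau> \<circ> \<pi>) A) {\<pi> \<in> bijections A L. \<pi> ` S = F}"
    proof (rule inj_onI)
      fix p q assume pq: "p \<in> {\<pi> \<in> bijections A L. \<pi> ` S = F}" "q \<in> {\<pi> \<in> bijections A L. \<pi> ` S = F}"
        and eq: "restrict (\<tau> \<circ> p) A = restrict (\<tau> \<circ> q) A"
      show "p = q"
      proof (rule PiE_ext[of _ A "\<lambda>_. L"])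
        show "p \<in> A \<rightarrow>\<^sub>E L" "q \<in> A \<rightarrow>\<^sub>E L" using pq by (auto simp: bijections_def)
      next
        fix x assume x: "x \<in> A"
        then have "\<tau> (p x) = \<tau> (q x)" using eq by (metis comp_apply restrict_apply')
        moreover have "p x \<in> L" "q x \<in> L" using pq x by (auto simp: bijections_def)
        ultimately show "p x = q x" using \<tau> by (auto simp: bij_betw_def inj_on_def)
      qed
    qed
    show "(\<lambda>\<pi>. restrict (\<tau> \<circ> \<pi>) A) ` {\<pi> \<in> bijections A L. \<pi> ` S = F} \<subseteq> {\<pi> \<in> bijections A L. \<pi> ` S = F'}"
    proof safe
      fix p assume p: "p \<in> bijections A L"
      then have "bij_betw (\<tau> \<circ> p) A L"
        using \<tau> by (auto simp: bijections_def intro: bij_betw_trans)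
      then have b: "bij_betw (restrict (\<tau> \<circ> p) A) A L"
        by (simp cong: bij_betw_cong)
      then show "restrict (\<tau> \<circ> p) A \<in> bijections A L"
        unfolding bijections_def by (auto simp: bij_betw_def)
      have im: "restrict (\<tau> \<circ> p) A ` S = \<tau> ` p ` S"
        using assms(3) by (auto simp: image_iff subset_iff) 
      {
        fix x assume "x \<in> S" "F = p ` S"
        then show "restrict (\<tau> \<circ> p) A x \<in> F'"
          using im \<tau>F by blast
      next
        fix x assume "x \<in> F'" "F = p ` S"
        then show "x \<in> restrict (\<tau> \<circ> p) A ` S"
          using im \<tau>F by blast
      }
    qed
    show "finite {\<pi> \<in> bijections A L. \<pi> ` S = F'}"
      using finite_bijections[OF assms(1,2)] by simp
  qed
qed

text \<open>By symmetry every subset of \<open>L\<close> of size \<open>card S\<close> is the image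
  of \<open>S\<close> under equally many bijections, so averaging over bijections is averaging over
  subsets of that size. The form without division also covers a vanishing binomial coefficient,
  where both sides are 0.\<close>

lemma sum_bijections_image:
  fixes h :: "'b set \<Rightarrow> real"
  assumes "finite A" "finite L" "S \<subseteq> A"
  shows "(\<Sum>\<pi>\<in>bijections A L. h (\<pi> ` S)) * (card L choose card S)
       = card (bijections A L) * (\<Sum>F | F \<subseteq> L \<and> card F = card S. h F)"
proof -
  let ?T = "{F. F \<subseteq> L \<and> card F = card S}" and ?P = "bijections A L"
  let ?c = "\<lambda>F. card {\<pi> \<in> ?P. \<pi> ` S = F}"
  have finT: "finite ?T" using assms(2) by (auto intro: finite_subset[of _ "Pow L"])
  have finP: "finite ?P" using assms finite_bijections by blast
  have img: "(\<lambda>\<pi>. \<pi> ` S) ` ?P \<subseteq> ?T" using bijections_image[OF _ assms(3)] by blast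
  have grp: "(\<Sum>\<pi>\<in>?P. f (\<pi> ` S)) = (\<Sum>F\<in>?T. real (?c F) * f F)" for f :: "'b set \<Rightarrow> real"
    unfolding sum.group[OF finP finT img, of "\<lambda>\<pi>. f (\<pi> ` S)", symmetric]
    by (intro sum.cong) auto
  have const: "?c F = ?c F'" if "F \<in> ?T" "F' \<in> ?T" for F F'
    using that assms
    by (intro antisym card_bijections_mapping_le) auto
  show ?thesis
  proof (cases "?T = {}")
    case True
    have "(\<Sum>\<pi>\<in>?P. h (\<pi> ` S)) = 0" "(\<Sum>F\<in>?T. h F) = 0"
      unfolding grp True by simp_all
    then show ?thesis by simp
  next
    case False
    then obtain F0 where F0: "F0 \<in> ?T" by blast
    have cT: "card ?T = card L choose card S" using n_subsets[OF assms(2)] by simp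
    \<comment> \<open>Grouping the constant function 1 by images determines the common fibre size
      \<open>?c F0\<close>.\<close>
    have "real (card ?P) = (\<Sum>F\<in>?T. real (?c F0))"
      using grp[of "\<lambda>_. 1"] const[OF _ F0] by simp
    then have P: "real (card ?P) = real (card L choose card S) * real (?c F0)"
      using cT by simp
    have "(\<Sum>\<pi>\<in>?P. h (\<pi> ` S)) = (\<Sum>F\<in>?T. real (?c F0) * h F)"
      unfolding grp using const[OF _ F0] by (intro sum.cong) auto
    then show ?thesis using P by (simp add: sum_distrib_left[symmetric])
  qed
qed

section \<open>The pointwise inequality between geometric and arithmetic mean\<close>

text \<open>The geometric mean over all bijections is computed through logarithms, which requires
  positive values. A vanishing factor with nonzero weight is therefore split off first. The
  condition \<open>g {} = 1\<close> makes vertices of degree 0 harmless, since no \<open>F\<close>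
  on the left corresponds to them.\<close>

lemma prod_wpow_le_average_bijections:
  fixes g :: "'l set \<Rightarrow> real" and N :: "'b \<Rightarrow> 'a set"
  assumes fin: "finite A" "finite L" "finite B" and card: "card A = card L"
    and N: "\<And>b. b \<in> B \<Longrightarrow> N b \<subseteq> A" "\<And>b. b \<in> B \<Longrightarrow> card (N b) \<le> r"
    and g: "\<And>F. 0 \<le> g F" "g {} = 1"
    and \<alpha>: "\<And>k. k \<in> {1..r} \<Longrightarrow> \<alpha> k = real (card {b\<in>B. card (N b) = k}) / real (card L choose k)"
  shows "(\<Prod>F | F \<subseteq> L \<and> 1 \<le> card F \<and> card F \<le> r. wpow (g F) (\<alpha> (card F)))
       \<le> (\<Sum>\<pi>\<in>bijections A L. \<Prod>b\<in>B. g (\<pi> ` N b)) / card (bijections A L)"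
    (is "(\<Prod>F\<in>?T. _) \<le> _")
proof -
  let ?P = "bijections A L"
  have finT: "finite ?T" using fin(2) by (auto intro: finite_subset[of _ "Pow L"])
  have finP: "finite ?P" using fin finite_bijections by blast
  have P0: "?P \<noteq> {}" using bijections_nonempty fin card by blast
  then have cP: "card ?P > 0" using finP by (simp add: card_gt_0_iff)
  have ch: "real (card L choose card F) > 0" if "F \<in> ?T" for F
    using that fin(2) by (simp add: card_mono)
  show ?thesis
  \<comment> \<open>In the first case one factor on the left is 0 and the right side is nonnegative.
    In the second, a value \<open>g F\<close> can vanish only where its weight is 0.\<close>
  proof (cases "\<exists>F\<in>?T. g F = 0 \<and> \<alpha> (card F) \<noteq> 0")
    case True
    then obtain F where F: "F \<in> ?T" "g F = 0" "\<alpha> (card F) \<noteq> 0" by blast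
    then have "wpow (g F) (\<alpha> (card F)) = 0" by (simp add: wpow_def)
    then have "(\<Prod>F\<in>?T. wpow (g F) (\<alpha> (card F))) = 0"
      using finT F(1) by (meson prod_zero)
    then show ?thesis using g(1) by (simp add: sum_nonneg prod_nonneg)
  next
    case False
    have pos: "g F > 0" if "F \<in> ?T" "\<alpha> (card F) \<noteq> 0" for F
      using False that g(1)[of F] by force
    \<comment> \<open>The vertex \<open>b\<close> itself is counted in the numerator of \<alpha> at
      \<open>card (N b)\<close>, so this weight is nonzero and \<open>pos\<close> applies to the
      image of \<open>N b\<close>.\<close>
    have gpos: "g (\<pi> ` N b) > 0" if "\<pi> \<in> ?P" "b \<in> B" for \<pi> b
    proof (cases "N b = {}")
      case True then show ?thesis using g(2) by simp
    next
      case False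
      have fN: "finite (N b)" using N(1)[OF that(2)] fin(1) finite_subset by blast
      have k: "card (\<pi> ` N b) = card (N b)" "\<pi> ` N b \<subseteq> L"
        using bijections_image[OF that(1) N(1)[OF that(2)]] by auto
      have c1: "card (N b) \<in> {1..r}" using False fN N(2)[OF that(2)] by (simp add: Suc_le_eq card_gt_0_iff)
      then have T: "\<pi> ` N b \<in> ?T" using k by auto
      have "card {b'\<in>B. card (N b') = card (N b)} > 0"
        using that(2) fin(3) by (auto simp: card_gt_0_iff)
      then have "\<alpha> (card (\<pi> ` N b)) > 0"
        using ch[OF T] \<alpha>[OF c1] k(1) by simp
      then show ?thesis using pos[OF T] by simp
    qed
    define h where "h = (\<lambda>F. ln (g F))"
    \<comment> \<open>The average over subsets of size \<open>card (N b)\<close> is written as a sum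
      over all of \<open>?T\<close>, so that the range does not depend on \<open>b\<close> and the
      sums over \<open>b\<close> and \<open>F\<close> can be exchanged. For empty \<open>N b\<close>
      both sides are 0, as \<open>ln 1 = 0\<close> and \<open>?T\<close> contains no empty
      set.\<close>
    have fibre: "(\<Sum>\<pi>\<in>?P. h (\<pi> ` N b)) / card ?P
        = (\<Sum>F\<in>?T. if card F = card (N b) then h F / (card L choose card F) else 0)"
      if b: "b \<in> B" for b
    proof (cases "N b = {}")
      case True
      then show ?thesis using g(2) by (auto simp: h_def intro!: sum.neutral)
    next
      case False
      have fN: "finite (N b)" using N(1)[OF b] fin(1) finite_subset by blast
      have c1: "1 \<le> card (N b)" using False fN by (simp add: Suc_le_eq card_gt_0_iff)
      have "card (N b) \<le> card L" using N(1)[OF b] fin(1) card card_mono by metis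
      then have C: "real (card L choose card (N b)) > 0" by simp
      have "(\<Sum>\<pi>\<in>?P. h (\<pi> ` N b)) / card ?P
          = (\<Sum>F | F \<subseteq> L \<and> card F = card (N b). h F) / (card L choose card (N b))"
        using sum_bijections_image[OF fin(1,2) N(1)[OF b], of h] C cP
        by (simp add: field_simps)
      also have "{F. F \<subseteq> L \<and> card F = card (N b)} = {F\<in>?T. card F = card (N b)}"
        using c1 N(2)[OF b] by auto
      also have "(\<Sum>F\<in>\<dots>. h F) / (card L choose card (N b)) = (\<Sum>F\<in>\<dots>. h F / (card L choose card F))"
        by (simp add: sum_divide_distrib)
      also have "\<dots> = (\<Sum>F\<in>?T. if card F = card (N b) then h F / (card L choose card F) else 0)"
        using finT by (subst sum.inter_filter) auto
      finally show ?thesis .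
    qed
    have "(\<Sum>\<pi>\<in>?P. \<Sum>b\<in>B. h (\<pi> ` N b)) / card ?P = (\<Sum>b\<in>B. (\<Sum>\<pi>\<in>?P. h (\<pi> ` N b)) / card ?P)"
      by (subst sum.swap) (simp add: sum_divide_distrib)
    also have "\<dots> = (\<Sum>F\<in>?T. \<Sum>b\<in>B. if card F = card (N b) then h F / (card L choose card F) else 0)"
      by (subst sum.swap) (simp add: fibre)
    also have "\<dots> = (\<Sum>F\<in>?T. \<alpha> (card F) * h F)"
    \<comment> \<open>Each \<open>b\<close> of degree \<open>card F\<close> contributes
      \<open>h F / (card L choose card F)\<close> once, so the total coefficient of
      \<open>h F\<close> is the prescribed weight.\<close>
    proof (rule sum.cong[OF refl])
      fix F assume F: "F \<in> ?T"
      have "(\<Sum>b\<in>B. if card F = card (N b) then h F / (card L choose card F) else 0)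
          = (\<Sum>b\<in>{b\<in>B. card F = card (N b)}. h F / (card L choose card F))"
        using fin(3) by (subst sum.inter_filter) auto
      also have "\<dots> = real (card {b\<in>B. card (N b) = card F}) * (h F / (card L choose card F))"
        by (simp only: sum_constant eq_commute[of "card F"])
      finally show "(\<Sum>b\<in>B. if card F = card (N b) then h F / (card L choose card F) else 0)
          = \<alpha> (card F) * h F"
        using \<alpha>[of "card F"] F by simp
    qed
    finally have log: "(\<Sum>\<pi>\<in>?P. \<Sum>b\<in>B. h (\<pi> ` N b)) / card ?P = (\<Sum>F\<in>?T. \<alpha> (card F) * h F)" .
    have "(\<Prod>F\<in>?T. wpow (g F) (\<alpha> (card F))) = (\<Prod>F\<in>?T. exp (\<alpha> (card F) * h F))"
    proof (rule prod.cong[OF refl])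
      fix F assume F: "F \<in> ?T"
      show "wpow (g F) (\<alpha> (card F)) = exp (\<alpha> (card F) * h F)"
      \<comment> \<open>At weight 0 both sides are 1, even if \<open>g F = 0\<close> and
        \<open>h F\<close> carries no information.\<close>
      proof (cases "\<alpha> (card F) = 0")
        case False
        with pos[OF F] show ?thesis by (simp add: wpow_def powr_def h_def)
      qed (simp add: wpow_def)
    qed
    also have "\<dots> = exp ((\<Sum>\<pi>\<in>?P. \<Sum>b\<in>B. h (\<pi> ` N b)) / card ?P)"
      using finT by (simp add: exp_sum log)
    also have "\<dots> = (\<Prod>\<pi>\<in>?P. \<Prod>b\<in>B. g (\<pi> ` N b)) powr (1 / card ?P)"
    proof -
      have *: "(\<Prod>\<pi>\<in>?P. \<Prod>b\<in>B. g (\<pi> ` N b)) = exp (\<Sum>\<pi>\<in>?P. \<Sum>b\<in>B. h (\<pi> ` N b))"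
        using finP fin(3) gpos by (simp add: exp_sum h_def)
      show ?thesis unfolding * by (simp add: powr_def)
    qed
    also have "\<dots> \<le> (\<Sum>\<pi>\<in>?P. (\<Prod>b\<in>B. g (\<pi> ` N b)) / card ?P)"
      by (rule arith_geom_mean[OF finP P0]) (simp add: prod_nonneg g(1))
    finally show ?thesis by (simp add: sum_divide_distrib)
  qed
qed

section \<open>Uniform measure, completion and almost everywhere equality\<close>

abbreviation unit_interval :: "real measure" where
  "unit_interval \<equiv> restrict_space lborel {0..1}"

lemma prob_space_unit_interval: "prob_space unit_interval"
  by (rule prob_space_restrict_space) auto

lemma prob_space_PiM_unit_interval: "prob_space (\<Pi>\<^sub>M v\<in>V. unit_interval)"
  by (intro prob_space_PiM prob_space_unit_interval)

lemma space_unit_interval [simp]: "space unit_interval = {0..1}"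
  by (simp add: space_restrict_space)

lemma measurable_unit_interval_borel:
  "f \<in> M \<rightarrow>\<^sub>M unit_interval \<Longrightarrow> f \<in> borel_measurable M"
  by (simp add: measurable_restrict_space2_iff)

interpretation unit_product: product_sigma_finite "\<lambda>_. unit_interval"
  by (intro product_sigma_finite.intro prob_space_imp_sigma_finite prob_space_unit_interval)

text \<open>Every subset of a null set is measurable for the completion. Hence \<open>f\<close>,
  which differs from the measurable \<open>g\<close> only inside a null set, is measurable there,
  and this passes from integrands built from a Lebesgue measurable function to Borel ones.\<close>

lemma integral_completion_cong_AE:
  fixes f g :: "'a \<Rightarrow> real"
  assumes g: "g \<in> borel_measurable M" and ae: "AE x in M. f x = g x"
  shows "integral\<^sup>L (completion M) f = integral\<^sup>L M g"
proof -
  have g': "g \<in> borel_measurable (completion M)" using g by (rule measurable_completion)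
  obtain N where N: "N \<in> null_sets M" "{x\<in>space M. f x \<noteq> g x} \<subseteq> N"
    using ae by (auto elim!: AE_E simp: null_sets_def)
  have "f \<in> borel_measurable (completion M)"
  proof (rule measurableI)
    fix A :: "real set" assume A: "A \<in> sets borel"
    define D where "D = f -` A \<inter> N \<inter> space M"
    have "D \<in> sets (completion M)"
      by (rule sets_completionI_sub[OF N(1)]) (auto simp: D_def)
    moreover have "g -` A \<inter> space (completion M) - N \<in> sets (completion M)"
      by (intro sets.Diff measurable_sets[OF g' A] null_setsD2 null_sets_completionI N(1))
    moreover have "f -` A \<inter> space (completion M) = (g -` A \<inter> space (completion M) - N) \<union> D"
      using N(2) by (auto simp: D_def)
    ultimately show "f -` A \<inter> space (completion M) \<in> sets (completion M)"
      by (simp only: sets.Un)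
  qed simp
  then have "integral\<^sup>L (completion M) f = integral\<^sup>L (completion M) g"
    using g' ae by (intro integral_cong_AE AE_completion)
  then show ?thesis using integral_completion[OF g] by simp
qed

text \<open>Multiplying by the indicator of the interval moves both integrals to the whole line,
  where \<open>lebesgue\<close> is the completion of \<open>lborel\<close>.\<close>

lemma integral_lebesgue_on_unit_cong_AE:
  fixes f g :: "real \<Rightarrow> real"
  assumes g: "g \<in> borel_measurable borel" and ae: "AE x in unit_interval. f x = g x"
  shows "integral\<^sup>L (lebesgue_on {0..1}) f = integral\<^sup>L unit_interval g"
proof -
  have "integral\<^sup>L (lebesgue_on {0..1}) f = integral\<^sup>L lebesgue (\<lambda>x. indicator {0..1} x *\<^sub>R f x)"
    by (rule integral_restrict_space) simp
  also have "\<dots> = integral\<^sup>L lborel (\<lambda>x. indicator {0..1} x *\<^sub>R g x)"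
  proof (rule integral_completion_cong_AE)
    show "AE x in lborel. indicator {0..1} x *\<^sub>R f x = indicator {0..1} x *\<^sub>R g x"
    proof -
      have "AE x in lborel. x \<in> {0..1} \<longrightarrow> f x = g x"
        using ae by (simp add: AE_restrict_space_iff)
      then show ?thesis by (rule eventually_mono) (simp add: indicator_def)
    qed
  qed (use g in simp)
  also have "\<dots> = integral\<^sup>L unit_interval g"
    by (rule integral_restrict_space[symmetric]) simp
  finally show ?thesis .
qed

section \<open>Borel representatives of graphons and avoidance of null sets\<close>

lemma graphon_Borel_representative:
  assumes "graphon W"
  obtains W' N where "W' \<in> borel_measurable borel" "\<And>p. 0 \<le> W' p" "\<And>p. W' p \<le> 1"
    "N \<in> null_sets lborel" "\<And>p. p \<in> {0..1} \<times> {0..1} \<Longrightarrow> p \<notin> N \<Longrightarrow> W p = W' p"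
proof -
  let ?S = "{0..1::real} \<times> {0..1::real}"
  have S: "?S \<in> sets lebesgue" by (intro sets_completionI_sets) (simp add: borel_Times)
  have "W \<in> borel_measurable (lebesgue_on ?S)"
    using assms by (simp add: graphon_def)
  then have "(\<lambda>p. indicator ?S p *\<^sub>R W p) \<in> borel_measurable lebesgue"
    using S by (subst (asm) borel_measurable_restrict_space_iff) auto
  then obtain g where g: "g \<in> borel_measurable lborel"
    and ae: "AE p in lborel. indicator ?S p *\<^sub>R W p = g p"
    using completion_ex_borel_measurable_real by blast
  obtain N where N: "N \<in> null_sets lborel" "{p. indicator ?S p *\<^sub>R W p \<noteq> g p} \<subseteq> N"
    using ae by (auto elim!: AE_E simp: null_sets_def)
  show ?thesis
  \<comment> \<open>Clamping to the unit interval makes the bounds hold everywhere. It changes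
    nothing at points of the square outside \<open>N\<close>, where \<open>g\<close> equals
    \<open>W\<close> and already lies between 0 and 1.\<close>
  proof (rule that[of "\<lambda>p. max 0 (min 1 (g p))" N])
    fix p :: "real \<times> real" assume p: "p \<in> ?S" "p \<notin> N"
    then have "indicator ?S p *\<^sub>R W p = g p" using N(2) by blast
    then have "W p = g p" using p(1) by (simp only: indicator_simps scaleR_one)
    moreover have "0 \<le> W p" "W p \<le> 1" using assms p(1) by (auto simp: graphon_def)
    ultimately show "W p = max 0 (min 1 (g p))" by simp
  qed (use g N in auto)
qed

text \<open>Fubini for null sets: almost every section of a null set of the plane is null.\<close>

lemma AE_pair_unit_interval:
  fixes N :: "(real \<times> real) set"
  assumes "N \<in> null_sets lborel"
  shows "AE x in unit_interval. AE y in unit_interval. (x, y) \<notin> N"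
proof -
  have "AE p in (lborel :: real measure) \<Otimes>\<^sub>M (lborel :: real measure). p \<notin> N"
    unfolding lborel_prod using assms by (rule AE_not_in)
  from lborel_pair.AE_pair[OF this] show ?thesis
    by (simp add: AE_restrict_space_iff eventually_mono)
qed

text \<open>Two distinct coordinates are independent and uniform, so their joint law is the product
  measure on the square, for which \<open>N\<close> is null. With \<open>i = j\<close> the pair
  would stay on the diagonal, which is itself a null set.\<close>

lemma AE_PiM_pair_unit_interval:
  fixes N :: "(real \<times> real) set"
  assumes N: "N \<in> null_sets lborel" and ij: "i \<in> V" "j \<in> V" "i \<noteq> j"
  shows "AE x in (\<Pi>\<^sub>M v\<in>V. unit_interval). (x i, x j) \<notin> N"
proof -
  interpret UU: pair_sigma_finite unit_interval unit_interval ..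
  have [measurable]: "N \<in> sets borel" using N by auto
  have ae: "AE p in unit_interval \<Otimes>\<^sub>M unit_interval. p \<notin> N"
  proof (rule UU.AE_pair_measure)
    have "fst \<in> borel_measurable (unit_interval \<Otimes>\<^sub>M unit_interval)" "snd \<in> borel_measurable (unit_interval \<Otimes>\<^sub>M unit_interval)"
      by (rule measurable_unit_interval_borel, rule measurable_fst measurable_snd)+
    then have "(\<lambda>p. (fst p, snd p)) \<in> borel_measurable (unit_interval \<Otimes>\<^sub>M unit_interval)"
      by (rule borel_measurable_Pair)
    then have "(\<lambda>p. (fst p, snd p)) -` (- N) \<inter> space (unit_interval \<Otimes>\<^sub>M unit_interval) \<in> sets (unit_interval \<Otimes>\<^sub>M unit_interval)"
      by (rule measurable_sets) (use N in \<open>auto intro: borel_comp\<close>)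
    moreover have "(\<lambda>p. (fst p, snd p)) -` (- N) \<inter> space (unit_interval \<Otimes>\<^sub>M unit_interval)
        = {p \<in> space (unit_interval \<Otimes>\<^sub>M unit_interval). p \<notin> N}" by auto
    ultimately show "{p \<in> space (unit_interval \<Otimes>\<^sub>M unit_interval). p \<notin> N} \<in> sets (unit_interval \<Otimes>\<^sub>M unit_interval)"
      by (simp only:)
  qed (rule AE_pair_unit_interval[OF N])
  have cb: "case_bool unit_interval unit_interval = (\<lambda>_. unit_interval)"
    by (auto split: bool.split)
  \<comment> \<open>The product over \<open>bool\<close> serves as intermediary: it is the binary
    product in another guise, and also the image of the big product under selecting two
    coordinates.\<close>
  have eq: "unit_interval \<Otimes>\<^sub>M unit_interval = distr (\<Pi>\<^sub>M b\<in>(UNIV :: bool set). unit_interval) (unit_interval \<Otimes>\<^sub>M unit_interval) (\<lambda>x. (x True, x False))"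
    by (rule pair_measure_eq_distr_PiM[OF unit_product.sigma_finite_measures unit_product.sigma_finite_measures, unfolded cb])
  from ae have "AE p in distr (\<Pi>\<^sub>M b\<in>(UNIV :: bool set). unit_interval) (unit_interval \<Otimes>\<^sub>M unit_interval) (\<lambda>x. (x True, x False)). p \<notin> N"
    by (simp only: eq[symmetric])
  then have 1: "AE x in (\<Pi>\<^sub>M b\<in>(UNIV :: bool set). unit_interval). (x True, x False) \<notin> N"
    by (rule AE_distrD[rotated]) (intro measurable_Pair measurable_component_singleton; simp)
  \<comment> \<open>This map from \<open>bool\<close> to \<open>V\<close> is injective because
    \<open>i \<noteq> j\<close>, as the reindexing of product measures requires.\<close>
  let ?f = "case_bool i j"
  have d: "distr (\<Pi>\<^sub>M v\<in>V. unit_interval) (\<Pi>\<^sub>M b\<in>UNIV. unit_interval) (\<lambda>\<omega>. \<lambda>n\<in>UNIV. \<omega> (?f n))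
      = (\<Pi>\<^sub>M b\<in>(UNIV :: bool set). unit_interval)"
    using ij by (intro distr_PiM_reindex) (auto simp: prob_space_unit_interval inj_on_def split: bool.splits)
  have m: "(\<lambda>\<omega>. \<lambda>n\<in>UNIV. \<omega> (?f n)) \<in> (\<Pi>\<^sub>M v\<in>V. unit_interval) \<rightarrow>\<^sub>M (\<Pi>\<^sub>M b\<in>(UNIV :: bool set). unit_interval)"
    using ij by (intro measurable_restrict measurable_component_singleton) (auto split: bool.split)
  have "AE x in distr (\<Pi>\<^sub>M v\<in>V. unit_interval) (\<Pi>\<^sub>M b\<in>UNIV. unit_interval) (\<lambda>\<omega>. \<lambda>n\<in>UNIV. \<omega> (?f n)). (x True, x False) \<notin> N"
    unfolding d by (rule 1)
  from AE_distrD[OF m this] show ?thesis by simp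
qed

section \<open>Edges and neighbourhoods of a bipartite graph\<close>

lemma edge_factor_pair:
  assumes "graphon W" "x i \<in> {0..1}" "x j \<in> {0..1}"
  shows "edge_factor W x {i, j} = W (x i, x j)"
  unfolding edge_factor_def
proof (rule the_equality)
  fix w assume "\<exists>k l. {i, j} = {k, l} \<and> w = W (x k, x l)"
  then obtain k l where "{i, j} = {k, l}" "w = W (x k, x l)" by blast
  moreover have "W (x j, x i) = W (x i, x j)" using assms by (simp add: graphon_def)
  ultimately show "w = W (x i, x j)" by (auto simp: doubleton_eq_iff)
qed blast

lemma nbhd_subset_left:
  assumes "bipartition H A B" "b \<in> B"
  shows "nbhd H b \<subseteq> A"
proof
  fix u assume "u \<in> nbhd H b"
  then obtain a c where "a \<in> A" "c \<in> B" "{u, b} = {a, c}"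
    using assms(1) by (auto simp: nbhd_def bipartition_def)
  moreover have "b \<notin> A" using assms by (auto simp: bipartition_def)
  ultimately show "u \<in> A" by (auto simp: doubleton_eq_iff)
qed

text \<open>Since \<open>A\<close> and \<open>B\<close> are disjoint, an edge determines which of
  its endpoints lies in \<open>B\<close>, so edges correspond bijectively to pairs of some
  \<open>b\<close> in \<open>B\<close> and a neighbour of \<open>b\<close>.\<close>

lemma prod_edges_bipartite:
  fixes f :: "'v set \<Rightarrow> 'c::comm_monoid_mult"
  assumes bip: "bipartition H A B" and fin: "finite A" "finite B"
  shows "(\<Prod>e\<in>edges H. f e) = (\<Prod>b\<in>B. \<Prod>a\<in>nbhd H b. f {a, b})"
proof -
  have N: "nbhd H b \<subseteq> A" if "b \<in> B" for b using nbhd_subset_left[OF bip that] .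
  have disj: "A \<inter> B = {}" using bip by (simp add: bipartition_def)
  have "bij_betw (\<lambda>(b, a). {a, b}) (Sigma B (nbhd H)) (edges H)"
    unfolding bij_betw_def
  proof
    show "inj_on (\<lambda>(b, a). {a, b}) (Sigma B (nbhd H))"
    proof (rule inj_onI, clarify)
      fix b a d c
      assume *: "b \<in> B" "a \<in> nbhd H b" "d \<in> B" "c \<in> nbhd H d" "{a, b} = {c, d}"
      then have "a \<in> A" "c \<in> A" using N by blast+
      then show "b = d \<and> a = c" using * disj by (auto simp: doubleton_eq_iff)
    qed
    show "(\<lambda>(b, a). {a, b}) ` Sigma B (nbhd H) = edges H"
    proof
      show "(\<lambda>(b, a). {a, b}) ` Sigma B (nbhd H) \<subseteq> edges H" by (auto simp: nbhd_def)
      show "edges H \<subseteq> (\<lambda>(b, a). {a, b}) ` Sigma B (nbhd H)"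
      proof
        fix e assume e: "e \<in> edges H"
        then obtain a b where ab: "b \<in> B" "e = {a, b}" using bip by (auto simp: bipartition_def)
        then have "(b, a) \<in> Sigma B (nbhd H)" using e by (simp add: nbhd_def)
        then show "e \<in> (\<lambda>(b, a). {a, b}) ` Sigma B (nbhd H)"
          using ab(2) by (intro image_eqI[where x = "(b, a)"]) auto
      qed
    qed
  qed
  from prod.reindex_bij_betw[OF this, of f]
  have "(\<Prod>e\<in>edges H. f e) = (\<Prod>p\<in>Sigma B (nbhd H). f {snd p, fst p})"
    by (simp add: case_prod_unfold)
  also have "\<dots> = (\<Prod>b\<in>B. \<Prod>a\<in>nbhd H b. f {a, b})"
    using fin N by (subst prod.Sigma) (auto intro: finite_subset simp: case_prod_unfold)
  finally show ?thesis .
qed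

section \<open>Codegrees of a Borel kernel\<close>

text \<open>The Borel counterpart of \<open>codegree\<close>: integration is over the uncompleted
  unit interval, which suits the Borel representative and Fubini on product measures.\<close>

definition rho :: "(real \<times> real \<Rightarrow> real) \<Rightarrow> 'v set \<Rightarrow> ('v \<Rightarrow> real) \<Rightarrow> real" where
  "rho W F x = (\<integral>y. (\<Prod>i\<in>F. W (x i, y)) \<partial>unit_interval)"

text \<open>For almost every \<open>x\<close>, the sections of \<open>N\<close> at all the finitely
  many \<open>x i\<close> are null. Outside such exceptional \<open>x\<close> the two integrands
  agree for almost every \<open>y\<close>, for all \<open>F\<close> simultaneously.\<close>

lemma AE_codegree_eq_rho:
  assumes "finite V"
    and W': "W' \<in> borel_measurable borel"
    and N: "N \<in> null_sets lborel" "\<And>p. p \<in> {0..1} \<times> {0..1} \<Longrightarrow> p \<notin> N \<Longrightarrow> W p = W' p"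
  shows "AE x in (\<Pi>\<^sub>M v\<in>V. unit_interval). \<forall>F\<subseteq>V. codegree W F x = rho W' F x"
proof -
  have "AE x in (\<Pi>\<^sub>M v\<in>V. unit_interval). AE y in unit_interval. (x i, y) \<notin> N" if "i \<in> V" for i
    using AE_pair_unit_interval[OF N(1)] that
    by (intro AE_PiM_component[where P = "\<lambda>t. AE y in unit_interval. (t, y) \<notin> N"] prob_space_unit_interval)
  then have "AE x in (\<Pi>\<^sub>M v\<in>V. unit_interval). \<forall>i\<in>V. AE y in unit_interval. (x i, y) \<notin> N"
    using assms(1) by (intro AE_finite_allI)
  then show ?thesis
    using AE_space
  proof eventually_elim
    case (elim x)
    show ?case
    proof (intro allI impI)
      fix F assume F: "F \<subseteq> V"
      then have finF: "finite F" using assms(1) finite_subset by blast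
      have "AE y in unit_interval. \<forall>i\<in>F. (x i, y) \<notin> N"
        using elim(1) F finF by (intro AE_finite_allI) blast+
      then have "AE y in unit_interval. (\<Prod>i\<in>F. W (x i, y)) = (\<Prod>i\<in>F. W' (x i, y))"
        using AE_space
      proof eventually_elim
        case (elim y)
        show ?case
        proof (rule prod.cong[OF refl])
          fix i assume i: "i \<in> F"
          then have "x i \<in> {0..1}" using F \<open>x \<in> space (\<Pi>\<^sub>M v\<in>V. unit_interval)\<close>
            by (auto simp: space_PiM PiE_iff)
          then show "W (x i, y) = W' (x i, y)"
            using elim i by (intro N(2)) auto
        qed
      qed
      then show "codegree W F x = rho W' F x"
        unfolding codegree_def rho_def
        by (rule integral_lebesgue_on_unit_cong_AE[rotated])
          (intro borel_measurable_prod measurable_compose[OF _ W'] borel_measurable_Pair borel_measurable_const; simp)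
    qed
  qed
qed

section \<open>Integrals of products of codegrees over the cube\<close>

context
  fixes W :: "real \<times> real \<Rightarrow> real"
  assumes W: "W \<in> borel_measurable borel" "\<And>p. 0 \<le> W p" "\<And>p. W p \<le> 1"
begin

lemma rho_nonneg: "0 \<le> rho W F x"
  unfolding rho_def by (intro Bochner_Integration.integral_nonneg prod_nonneg W)

lemma rho_empty: "rho W {} x = 1"
proof -
  interpret prob_space unit_interval by (rule prob_space_unit_interval)
  show ?thesis unfolding rho_def using prob_space by simp
qed

lemma integrable_section:
  "integrable unit_interval (\<lambda>y. \<Prod>i\<in>F. W (x i, y))"
proof -
  interpret prob_space unit_interval by (rule prob_space_unit_interval)
  show ?thesis
  proof (rule integrable_const_bound[where B = 1])
    show "AE y in unit_interval. norm (\<Prod>i\<in>F. W (x i, y)) \<le> 1"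
      by (intro AE_I2) (simp add: prod_nonneg prod_le_1 W(2,3))
    have "(\<lambda>y. \<Prod>i\<in>F. W (x i, y)) \<in> borel_measurable borel"
      by (intro borel_measurable_prod measurable_compose[OF _ W(1)] borel_measurable_Pair
          borel_measurable_const) simp
    then show "(\<lambda>y. \<Prod>i\<in>F. W (x i, y)) \<in> borel_measurable unit_interval"
      by (simp add: measurable_restrict_space1)
  qed
qed

lemma rho_le_1: "rho W F x \<le> 1"
proof -
  interpret prob_space unit_interval by (rule prob_space_unit_interval)
  have "rho W F x \<le> (\<integral>y. 1 \<partial>unit_interval)"
    unfolding rho_def
    by (intro integral_mono integrable_section integrable_const prod_le_1) (simp add: W(2,3))
  then show ?thesis using prob_space by simp
qed

lemma rho_image: "inj_on \<pi> F \<Longrightarrow> rho W (\<pi> ` F) z = rho W F (\<lambda>v. z (\<pi> v))"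
  unfolding rho_def by (simp add: prod.reindex)

lemma rho_cong: "(\<And>v. v \<in> F \<Longrightarrow> x v = y v) \<Longrightarrow> rho W F x = rho W F y"
  unfolding rho_def by (simp cong: prod.cong)

lemma borel_measurable_coordinate:
  "i \<in> V \<Longrightarrow> (\<lambda>x. x i) \<in> borel_measurable (\<Pi>\<^sub>M v\<in>V. unit_interval)"
  by (rule measurable_unit_interval_borel) (rule measurable_component_singleton)

lemma rho_measurable:
  assumes "F \<subseteq> V"
  shows "rho W F \<in> borel_measurable (\<Pi>\<^sub>M v\<in>V. unit_interval)"
proof -
  have "(\<lambda>p. \<Prod>i\<in>F. W (fst p i, snd p)) \<in> borel_measurable ((\<Pi>\<^sub>M v\<in>V. unit_interval) \<Otimes>\<^sub>M unit_interval)"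
    using assms
    by (intro borel_measurable_prod measurable_compose[OF _ W(1)] borel_measurable_Pair
        measurable_compose[OF measurable_fst borel_measurable_coordinate]
        measurable_unit_interval_borel[OF measurable_snd]) auto
  then have "(\<lambda>x. \<integral>y. (\<Prod>i\<in>F. W (x i, y)) \<partial>unit_interval) \<in> borel_measurable (\<Pi>\<^sub>M v\<in>V. unit_interval)"
    by (intro sigma_finite_measure.borel_measurable_lebesgue_integral[OF unit_product.sigma_finite_measures]) (simp add: case_prod_unfold)
  then show ?thesis unfolding rho_def .
qed

lemma integrable_prod_rho:
  assumes "\<And>b. b \<in> B \<Longrightarrow> N b \<subseteq> V"
  shows "integrable (\<Pi>\<^sub>M v\<in>V. unit_interval) (\<lambda>x. \<Prod>b\<in>B. rho W (N b) x)"
proof -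
  interpret prob_space "\<Pi>\<^sub>M v\<in>V. unit_interval" by (rule prob_space_PiM_unit_interval)
  show ?thesis
  proof (rule integrable_const_bound[where B = 1])
    show "AE x in (\<Pi>\<^sub>M v\<in>V. unit_interval). norm (\<Prod>b\<in>B. rho W (N b) x) \<le> 1"
      by (intro AE_I2) (simp add: prod_nonneg prod_le_1 rho_nonneg rho_le_1)
    show "(\<lambda>x. \<Prod>b\<in>B. rho W (N b) x) \<in> borel_measurable (\<Pi>\<^sub>M v\<in>V. unit_interval)"
      using assms by (intro borel_measurable_prod rho_measurable)
  qed
qed

lemma wpow_rho_measurable:
  assumes "F \<subseteq> V"
  shows "(\<lambda>x. wpow (rho W F x) a) \<in> borel_measurable (\<Pi>\<^sub>M v\<in>V. unit_interval)"
  unfolding wpow_def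
  using rho_measurable[OF assms] by measurable

text \<open>As \<pi> is injective and the coordinates are i.i.d.,
  \<open>z \<mapsto> z \<circ> \<pi>\<close> carries the uniform measure on the cube over
  \<open>L\<close> to the one over \<open>A\<close>. Under this change of variables
  \<open>N b\<close> becomes its image under \<pi>.\<close>

lemma integral_prod_rho_bijection:
  assumes "\<pi> \<in> bijections A L" and N: "\<And>b. b \<in> B \<Longrightarrow> N b \<subseteq> A"
  shows "(\<integral>x. (\<Prod>b\<in>B. rho W (N b) x) \<partial>(\<Pi>\<^sub>M v\<in>A. unit_interval))
       = (\<integral>z. (\<Prod>b\<in>B. rho W (\<pi> ` N b) z) \<partial>(\<Pi>\<^sub>M v\<in>L. unit_interval))"
proof -
  let ?f = "\<lambda>z. \<lambda>v\<in>A. z (\<pi> v)"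
  have \<pi>: "inj_on \<pi> A" "\<pi> \<in> A \<rightarrow> L"
    using assms(1) by (auto simp: bijections_def bij_betw_def)
  have d: "distr (\<Pi>\<^sub>M v\<in>L. unit_interval) (\<Pi>\<^sub>M v\<in>A. unit_interval) ?f = (\<Pi>\<^sub>M v\<in>A. unit_interval)"
    by (rule distr_PiM_reindex[OF prob_space_unit_interval \<pi>])
  have "(\<integral>x. (\<Prod>b\<in>B. rho W (N b) x) \<partial>(\<Pi>\<^sub>M v\<in>A. unit_interval))
      = (\<integral>z. (\<Prod>b\<in>B. rho W (N b) (?f z)) \<partial>(\<Pi>\<^sub>M v\<in>L. unit_interval))"
  proof (subst d[symmetric], rule integral_distr)
    show "?f \<in> (\<Pi>\<^sub>M v\<in>L. unit_interval) \<rightarrow>\<^sub>M (\<Pi>\<^sub>M v\<in>A. unit_interval)"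
      using \<pi>(2) by (intro measurable_restrict measurable_component_singleton) auto
    show "(\<lambda>x. \<Prod>b\<in>B. rho W (N b) x) \<in> borel_measurable (\<Pi>\<^sub>M v\<in>A. unit_interval)"
      using N by (intro borel_measurable_prod rho_measurable)
  qed
  also have "\<dots> = (\<integral>z. (\<Prod>b\<in>B. rho W (\<pi> ` N b) z) \<partial>(\<Pi>\<^sub>M v\<in>L. unit_interval))"
  proof (intro Bochner_Integration.integral_cong refl prod.cong)
    fix z b assume b: "b \<in> B"
    have "rho W (N b) (?f z) = rho W (N b) (\<lambda>v. z (\<pi> v))"
      using N[OF b] by (intro rho_cong) auto
    also have "\<dots> = rho W (\<pi> ` N b) z"
      using inj_on_subset[OF \<pi>(1) N[OF b]] by (rule rho_image[symmetric])
    finally show "rho W (N b) (?f z) = rho W (\<pi> ` N b) z" .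
  qed
  finally show ?thesis .
qed

text \<open>With the coordinates in \<open>A\<close> fixed, the factor belonging to \<open>b\<close>
  depends on the single coordinate \<open>y b\<close>. The inner integral over the cube of
  \<open>B\<close> therefore splits into a product of one-dimensional integrals, each of them a
  codegree.\<close>

lemma integral_bipartite_product:
  assumes fin: "finite A" "finite B" and disj: "A \<inter> B = {}" and N: "\<And>b. b \<in> B \<Longrightarrow> N b \<subseteq> A"
  shows "(\<integral>x. (\<Prod>b\<in>B. \<Prod>a\<in>N b. W (x a, x b)) \<partial>(\<Pi>\<^sub>M v\<in>A \<union> B. unit_interval))
       = (\<integral>x. (\<Prod>b\<in>B. rho W (N b) x) \<partial>(\<Pi>\<^sub>M v\<in>A. unit_interval))"
    and "(\<lambda>x. \<Prod>b\<in>B. \<Prod>a\<in>N b. W (x a, x b)) \<in> borel_measurable (\<Pi>\<^sub>M v\<in>A \<union> B. unit_interval)"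
proof -
  let ?f = "\<lambda>x. \<Prod>b\<in>B. \<Prod>a\<in>N b. W (x a, x b)"
  interpret AB: prob_space "\<Pi>\<^sub>M v\<in>A \<union> B. unit_interval" by (rule prob_space_PiM_unit_interval)
  show meas: "?f \<in> borel_measurable (\<Pi>\<^sub>M v\<in>A \<union> B. unit_interval)"
    using N by (intro borel_measurable_prod measurable_compose[OF _ W(1)] borel_measurable_Pair
        borel_measurable_coordinate) auto
  have "integrable (\<Pi>\<^sub>M v\<in>A \<union> B. unit_interval) ?f"
    by (rule AB.integrable_const_bound[where B = 1])
      (auto intro!: AE_I2 meas simp: prod_nonneg prod_le_1 W(2,3))
  then have "integral\<^sup>L (\<Pi>\<^sub>M v\<in>A \<union> B. unit_interval) ?f
      = (\<integral>x. (\<integral>y. ?f (merge A B (x, y)) \<partial>(\<Pi>\<^sub>M v\<in>B. unit_interval)) \<partial>(\<Pi>\<^sub>M v\<in>A. unit_interval))"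
    by (rule unit_product.product_integral_fold[OF disj fin])
  also have "\<dots> = (\<integral>x. (\<Prod>b\<in>B. rho W (N b) x) \<partial>(\<Pi>\<^sub>M v\<in>A. unit_interval))"
  proof (rule Bochner_Integration.integral_cong[OF refl])
    fix x
    have "?f (merge A B (x, y)) = (\<Prod>b\<in>B. \<Prod>a\<in>N b. W (x a, y b))" for y
    proof (intro prod.cong refl)
      fix a b assume "b \<in> B" "a \<in> N b"
      then show "W (merge A B (x, y) a, merge A B (x, y) b) = W (x a, y b)"
        using N disj by (auto simp: merge_def)
    qed
    then show "(\<integral>y. ?f (merge A B (x, y)) \<partial>(\<Pi>\<^sub>M v\<in>B. unit_interval)) = (\<Prod>b\<in>B. rho W (N b) x)"
      unfolding rho_def
      using unit_product.product_integral_prod[where f = "\<lambda>b y. \<Prod>a\<in>N b. W (x a, y)", OF fin(2) integrable_section]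
      by simp
  qed
  finally show "integral\<^sup>L (\<Pi>\<^sub>M v\<in>A \<union> B. unit_interval) ?f
      = (\<integral>x. (\<Prod>b\<in>B. rho W (N b) x) \<partial>(\<Pi>\<^sub>M v\<in>A. unit_interval))" .
qed

end

section \<open>Both densities as integrals for the Borel representative\<close>

lemma hom_density_bipartite:
  assumes H: "finite_simple_graph H" "bipartition H A B" and "graphon W"
    and W': "W' \<in> borel_measurable borel" "\<And>p. 0 \<le> W' p" "\<And>p. W' p \<le> 1"
    and N: "N \<in> null_sets lborel" "\<And>p. p \<in> {0..1} \<times> {0..1} \<Longrightarrow> p \<notin> N \<Longrightarrow> W p = W' p"
  shows "hom_density H W = (\<integral>x. (\<Prod>b\<in>B. rho W' (nbhd H b) x) \<partial>(\<Pi>\<^sub>M v\<in>A. unit_interval))"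
proof -
  have V: "verts H = A \<union> B" and disj: "A \<inter> B = {}" using H(2) by (auto simp: bipartition_def)
  then have fin: "finite A" "finite B" using H(1) by (auto simp: finite_simple_graph_def)
  have nb: "nbhd H b \<subseteq> A" if "b \<in> B" for b using nbhd_subset_left[OF H(2) that] .
  let ?M = "\<Pi>\<^sub>M v\<in>A \<union> B. unit_interval"
  \<comment> \<open>Vertices from opposite parts are distinct, so their coordinates almost surely
    form a pair outside \<open>N\<close>; only finitely many pairs occur.\<close>
  have "AE x in ?M. (x a, x b) \<notin> N" if "b \<in> B" "a \<in> A" for a b
    using that disj by (intro AE_PiM_pair_unit_interval N(1)) auto
  then have "AE x in ?M. \<forall>b\<in>B. \<forall>a\<in>A. (x a, x b) \<notin> N"
    using fin by (intro AE_finite_allI)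
  then have ae: "AE x in ?M. (\<Prod>e\<in>edges H. edge_factor W x e) = (\<Prod>b\<in>B. \<Prod>a\<in>nbhd H b. W' (x a, x b))"
    using AE_space
  proof eventually_elim
    case (elim x)
    show ?case
      unfolding prod_edges_bipartite[OF H(2) fin]
    proof (intro prod.cong refl)
      fix a b assume ab: "b \<in> B" "a \<in> nbhd H b"
      then have a: "a \<in> A" using nb by blast
      then have x: "x a \<in> {0..1}" "x b \<in> {0..1}" using elim(2) ab(1) by (auto simp: space_PiM PiE_iff)
      have "W (x a, x b) = W' (x a, x b)" using elim(1) a ab(1) x by (intro N(2)) auto
      then show "edge_factor W x {a, b} = W' (x a, x b)"
        using edge_factor_pair[of W x a b] assms(3) x by simp
    qed
  qed
  have "hom_density H W = (\<integral>x. (\<Prod>b\<in>B. \<Prod>a\<in>nbhd H b. W' (x a, x b)) \<partial>?M)"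
    unfolding hom_density_def unit_cube_def V
    by (rule integral_completion_cong_AE[OF integral_bipartite_product(2)[OF W' fin disj nb] ae])
  also have "\<dots> = (\<integral>x. (\<Prod>b\<in>B. rho W' (nbhd H b) x) \<partial>(\<Pi>\<^sub>M v\<in>A. unit_interval))"
    by (rule integral_bipartite_product(1)[OF W' fin disj nb])
  finally show ?thesis .
qed

lemma nbhd_downset_graph:
  assumes "Inr F \<in> downset_right m r"
  shows "nbhd (downset_graph m r) (Inr F) = Inl ` F"
  using assms by (auto simp: nbhd_def downset_graph_def downset_left_def downset_right_def doubleton_eq_iff)

text \<open>Taking neighbourhoods is a bijection from the right vertices onto the subsets of the
  left part of size 1 to \<open>r\<close>. The product is thereby indexed by subsets of the left
  part, the form in which the averaging over bijections delivers it.\<close>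

lemma downset_density_eq_rho:
  assumes W': "W' \<in> borel_measurable borel" "\<And>p. 0 \<le> W' p" "\<And>p. W' p \<le> 1"
    and N: "N \<in> null_sets lborel" "\<And>p. p \<in> {0..1} \<times> {0..1} \<Longrightarrow> p \<notin> N \<Longrightarrow> W p = W' p"
  shows "downset_density m r \<alpha> W
    = (\<integral>x. (\<Prod>F | F \<subseteq> downset_left m \<and> 1 \<le> card F \<and> card F \<le> r. wpow (rho W' F x) (\<alpha> (card F)))
        \<partial>(\<Pi>\<^sub>M v\<in>downset_left m. unit_interval))"
proof -
  let ?L = "downset_left m" and ?J = "downset_graph m r"
  let ?T = "{F. F \<subseteq> ?L \<and> 1 \<le> card F \<and> card F \<le> r}"
  have finL: "finite ?L" by (simp add: downset_left_def)
  have "inj_on (nbhd ?J) (downset_right m r)"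
  proof (rule inj_onI)
    fix u v assume uv: "u \<in> downset_right m r" "v \<in> downset_right m r" "nbhd ?J u = nbhd ?J v"
    then obtain F G where FG: "u = Inr F" "v = Inr G" by (auto simp: downset_right_def)
    then have "Inl ` F = (Inl ` G :: (nat + nat set) set)" using uv by (simp add: nbhd_downset_graph)
    then show "u = v" using FG by (simp add: inj_image_eq_iff)
  qed
  moreover have "nbhd ?J ` downset_right m r = ?T"
  proof (intro equalityI subsetI)
    fix F assume "F \<in> nbhd ?J ` downset_right m r"
    then obtain G where G: "Inr G \<in> downset_right m r" "F = nbhd ?J (Inr G)" by (auto simp: downset_right_def)
    then have "F = Inl ` G" by (simp add: nbhd_downset_graph)
    then show "F \<in> ?T" using G(1) by (auto simp: downset_right_def downset_left_def card_image)
  next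
    fix F assume F: "F \<in> ?T"
    then obtain G where G: "G \<subseteq> {1..m}" "F = Inl ` G"
      unfolding downset_left_def by (auto simp: subset_image_iff)
    then have "Inr G \<in> downset_right m r" using F by (auto simp: downset_right_def card_image)
    then show "F \<in> nbhd ?J ` downset_right m r"
      using G(2) nbhd_downset_graph by (metis imageI)
  qed
  ultimately have bij: "bij_betw (nbhd ?J) (downset_right m r) ?T" by (simp add: bij_betw_def)
  have "downset_density m r \<alpha> W
      = (\<integral>x. (\<Prod>F\<in>?T. wpow (codegree W F x) (\<alpha> (card F))) \<partial>unit_cube ?L)"
    unfolding downset_density_def weighted_density_def vdegree_def
    by (simp add: prod.reindex_bij_betw[OF bij, of "\<lambda>F. wpow (codegree W F _) (\<alpha> (card F))"])
  also have "\<dots> = (\<integral>x. (\<Prod>F\<in>?T. wpow (rho W' F x) (\<alpha> (card F))) \<partial>(\<Pi>\<^sub>M v\<in>?L. unit_interval))"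
    unfolding unit_cube_def
  proof (rule integral_completion_cong_AE)
    show "(\<lambda>x. \<Prod>F\<in>?T. wpow (rho W' F x) (\<alpha> (card F))) \<in> borel_measurable (\<Pi>\<^sub>M v\<in>?L. unit_interval)"
      by (intro borel_measurable_prod wpow_rho_measurable W') auto
    show "AE x in (\<Pi>\<^sub>M v\<in>?L. unit_interval). (\<Prod>F\<in>?T. wpow (codegree W F x) (\<alpha> (card F)))
        = (\<Prod>F\<in>?T. wpow (rho W' F x) (\<alpha> (card F)))"
      using AE_codegree_eq_rho[OF finL W'(1) N]
      by (rule eventually_mono) (auto intro: prod.cong)
  qed
  finally show ?thesis .
qed

section \<open>Integration of the pointwise inequality\<close>

theorem theorem4p1:
  fixes H :: "'v sgraph" and A B :: "'v set" and r :: nat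
    and \<alpha> :: "nat \<Rightarrow> real" and W :: "real \<times> real \<Rightarrow> real"
  assumes "finite_simple_graph H"
    and "bipartition H A B"
    and "r = Max (vdegree H ` B)"
    and "\<And>k. k \<in> {1..r} \<Longrightarrow>
           \<alpha> k = real (card {b \<in> B. vdegree H b = k}) / real (card A choose k)"
    and "graphon W"
  shows "hom_density H W \<ge> downset_density (card A) r \<alpha> W"
proof -
  obtain W' N where W': "W' \<in> borel_measurable borel" "\<And>p. 0 \<le> W' p" "\<And>p. W' p \<le> 1"
    and N: "N \<in> null_sets lborel" "\<And>p. p \<in> {0..1} \<times> {0..1} \<Longrightarrow> p \<notin> N \<Longrightarrow> W p = W' p"
    using graphon_Borel_representative[OF assms(5)] by metis
  have "verts H = A \<union> B" using assms(2) by (simp add: bipartition_def)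
  then have fin: "finite A" "finite B" using assms(1) by (auto simp: finite_simple_graph_def)
  have nb: "nbhd H b \<subseteq> A" if "b \<in> B" for b using nbhd_subset_left[OF assms(2) that] .
  \<comment> \<open>For empty \<open>B\<close> the value \<open>r\<close> is the unspecified
    \<open>Max {}\<close>, and the bound holds vacuously.\<close>
  have deg: "card (nbhd H b) \<le> r" if "b \<in> B" for b
    using that fin(2) assms(3) by (simp add: vdegree_def[symmetric])
  let ?L = "downset_left (card A)"
  let ?P = "bijections A ?L" and ?M = "\<Pi>\<^sub>M v\<in>?L. unit_interval"
  let ?g = "\<lambda>x. \<Prod>F | F \<subseteq> ?L \<and> 1 \<le> card F \<and> card F \<le> r. wpow (rho W' F x) (\<alpha> (card F))"
  let ?h = "\<lambda>\<pi> x. \<Prod>b\<in>B. rho W' (\<pi> ` nbhd H b) x"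
  have L: "finite ?L" "card A = card ?L" by (simp_all add: downset_left_def card_image)
  have cP: "card ?P > 0"
    using finite_bijections[OF fin(1) L(1)] bijections_nonempty[OF fin(1) L] by (simp add: card_gt_0_iff)
  have int: "integrable ?M (?h \<pi>)" if "\<pi> \<in> ?P" for \<pi>
    using bijections_image(1)[OF that nb] by (intro integrable_prod_rho W')
  have le: "?g x \<le> (\<Sum>\<pi>\<in>?P. ?h \<pi> x) / card ?P" for x
  proof (rule prod_wpow_le_average_bijections[OF fin(1) L(1) fin(2) L(2) nb deg])
    show "0 \<le> rho W' F x" for F by (rule rho_nonneg[OF W'])
    show "rho W' {} x = 1" by (rule rho_empty[OF W'])
    show "\<alpha> k = real (card {b \<in> B. card (nbhd H b) = k}) / real (card ?L choose k)" if "k \<in> {1..r}" for k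
      using assms(4)[OF that] L(2) by (simp add: vdegree_def)
  qed
  have "downset_density (card A) r \<alpha> W = integral\<^sup>L ?M ?g"
    by (rule downset_density_eq_rho[OF W' N])
  also have "\<dots> \<le> (\<integral>x. (\<Sum>\<pi>\<in>?P. ?h \<pi> x) / card ?P \<partial>?M)"
  \<comment> \<open>An integrable nonnegative upper bound suffices for this rule: a non-integrable
    left side would have integral 0 by convention.\<close>
  proof (rule integral_mono')
    show "integrable ?M (\<lambda>x. (\<Sum>\<pi>\<in>?P. ?h \<pi> x) / card ?P)"
      using int by (intro integrable_divide Bochner_Integration.integrable_sum)
    show "0 \<le> (\<Sum>\<pi>\<in>?P. ?h \<pi> x) / card ?P" for x
      by (intro divide_nonneg_nonneg sum_nonneg prod_nonneg rho_nonneg W') simp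
  qed (rule le)
  also have "\<dots> = (\<Sum>\<pi>\<in>?P. integral\<^sup>L ?M (?h \<pi>)) / card ?P"
    using int by (simp add: Bochner_Integration.integral_sum)
  \<comment> \<open>Relabelling does not change the integral, so every bijection contributes the
    same value and the average collapses to the density of \<open>H\<close>.\<close>
  also have "(\<Sum>\<pi>\<in>?P. integral\<^sup>L ?M (?h \<pi>)) = (\<Sum>\<pi>\<in>?P. hom_density H W)"
  proof (rule sum.cong[OF refl])
    fix \<pi> assume "\<pi> \<in> ?P"
    from integral_prod_rho_bijection[OF W', where N = "nbhd H" and B = B, OF this nb] show "integral\<^sup>L ?M (?h \<pi>) = hom_density H W"
      using hom_density_bipartite[OF assms(1,2,5) W' N] by simp
  qed
  also have "\<dots> / card ?P = hom_density H W" using cP by simp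
  finally show ?thesis .
qed

end
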